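(* Let $X$ be a proper, geodesically complete, CAT$(0)$-space and let $G<\text{Isom}(X)$ be closed, totally disconnected, unimodular and cocompact. Then there exists $M\in\mathbb{N}$ such that every prime number appearing in the prime decomposition of the order of every finite order isometry of $G$ is at most $M$.
   Context: For a proper metric space $X$, $\text{Isom}(X)$ carries the compact-open topology. A locally compact group is unimodular if it admits a Haar measure that is both left and right invariant. A closed subgroup $G<\text{Isom}(X)$ is cocompact if the quotient metric space $G\backslash X$ is compact. A CAT$(0)$-space is geodesically complete if every geodesic segment can be extended to a geodesic line. *)

theory Defs
  imports
    "HOL-Analysis.Analysis"
    "HOL-Algebra.Group_Action"
    "HOL-Algebra.Multiplicative_Group"
    "HOL-Computational_Algebra.Primes"
begin

definition isometric_on :: "'a::metric_space set \<Rightarrow> ('a \<Rightarrow> 'b::metric_space) \<Rightarrow> bool" where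
  "isometric_on S f \<longleftrightarrow> (\<forall>s\<in>S. \<forall>t\<in>S. dist (f s) (f t) = dist s t)"

definition proper_space :: "'a::metric_space itself \<Rightarrow> bool" where
  "proper_space _ \<longleftrightarrow> (\<forall>(x::'a) r. compact (cball x r))"

definition geodesic_segment :: "'a::metric_space \<Rightarrow> 'a \<Rightarrow> 'a set \<Rightarrow> bool" where
  "geodesic_segment x y S \<longleftrightarrow>
     (\<exists>c :: real \<Rightarrow> 'a. isometric_on {0..dist x y} c \<and> c 0 = x \<and> c (dist x y) = y
        \<and> S = c ` {0..dist x y})"

definition geodesic_space :: "'a::metric_space itself \<Rightarrow> bool" where
  "geodesic_space _ \<longleftrightarrow> (\<forall>x y :: 'a. \<exists>S. geodesic_segment x y S)"

text \<open>
  Every geodesic triangle is thinner than its comparison triangle \<open>x' y' z'\<close> in the Euclidean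
  plane. The points \<open>p\<close> and \<open>q\<close> lie on the sides issuing from \<open>x\<close>; as the vertices may be
  permuted, this covers any two distinct sides, and two points on the same side always satisfy
  the inequality.
\<close>

definition CAT0_space :: "'a::metric_space itself \<Rightarrow> bool" where
  "CAT0_space _ \<longleftrightarrow> geodesic_space TYPE('a) \<and>
     (\<forall>(x::'a) y z A B C. \<forall>(x'::real^2) y' z'.
        geodesic_segment x y A \<and> geodesic_segment x z B \<and> geodesic_segment y z C \<and>
        dist x' y' = dist x y \<and> dist x' z' = dist x z \<and> dist y' z' = dist y z \<longrightarrow>
        (\<forall>p\<in>A. \<forall>q\<in>B. \<forall>p'\<in>closed_segment x' y'. \<forall>q'\<in>closed_segment x' z'.
           dist x' p' = dist x p \<and> dist x' q' = dist x q \<longrightarrow> dist p q \<le> dist p' q'))"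

text \<open>Only nondegenerate segments are considered, so a single point is geodesically complete.\<close>

definition geodesically_complete :: "'a::metric_space itself \<Rightarrow> bool" where
  "geodesically_complete _ \<longleftrightarrow>
     (\<forall>a b (c :: real \<Rightarrow> 'a). a < b \<and> isometric_on {a..b} c \<longrightarrow>
        (\<exists>l :: real \<Rightarrow> 'a. isometric_on UNIV l \<and> (\<forall>t\<in>{a..b}. l t = c t)))"

definition isom_group :: "('a::metric_space \<Rightarrow> 'a) monoid" where
  "isom_group = \<lparr>carrier = {f. bij f \<and> isometric_on UNIV f}, mult = (\<circ>), one = id\<rparr>"

definition isom_topology :: "('a::metric_space \<Rightarrow> 'a) topology" where
  "isom_topology = topology_generated_by
     {{f \<in> carrier isom_group. f ` K \<subseteq> U} | K U. compact K \<and> open U}"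

definition totally_disconnected_space :: "'b topology \<Rightarrow> bool" where
  "totally_disconnected_space T \<longleftrightarrow> (\<forall>C. connectedin T C \<longrightarrow> (\<exists>x. C \<subseteq> {x}))"

definition radon_measure :: "'b topology \<Rightarrow> 'b measure \<Rightarrow> bool" where
  "radon_measure T \<mu> \<longleftrightarrow>
     sets \<mu> = sigma_sets (topspace T) {U. openin T U} \<and>
     (\<forall>K. compactin T K \<longrightarrow> emeasure \<mu> K < \<infinity>) \<and>
     (\<forall>A\<in>sets \<mu>. emeasure \<mu> A = (INF U\<in>{U. openin T U \<and> A \<subseteq> U}. emeasure \<mu> U)) \<and>
     (\<forall>U. openin T U \<longrightarrow> emeasure \<mu> U = (SUP K\<in>{K. compactin T K \<and> K \<subseteq> U}. emeasure \<mu> K))"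

definition left_haar_measure :: "('b, 'c) monoid_scheme \<Rightarrow> 'b topology \<Rightarrow> 'b measure \<Rightarrow> bool" where
  "left_haar_measure G T \<mu> \<longleftrightarrow> radon_measure T \<mu> \<and> emeasure \<mu> (topspace T) \<noteq> 0 \<and>
     (\<forall>g\<in>carrier G. \<forall>A\<in>sets \<mu>. emeasure \<mu> (g <#\<^bsub>G\<^esub> A) = emeasure \<mu> A)"

definition unimodular :: "('b, 'c) monoid_scheme \<Rightarrow> 'b topology \<Rightarrow> bool" where
  "unimodular G T \<longleftrightarrow> (\<exists>\<mu>. left_haar_measure G T \<mu> \<and>
     (\<forall>g\<in>carrier G. \<forall>A\<in>sets \<mu>. emeasure \<mu> (A #>\<^bsub>G\<^esub> g) = emeasure \<mu> A))"

text \<open>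
  The distance between two orbits is the infimum of the distances between their points. It is a
  metric on the set of orbits when \<open>G\<close> is a closed group of isometries of a proper space, since
  then orbits are closed (and it is always a pseudometric).
\<close>

definition cocompact :: "('a::metric_space \<Rightarrow> 'a) set \<Rightarrow> bool" where
  "cocompact G \<longleftrightarrow> compact_space
     (Metric_space.mtopology (orbits (isom_group\<lparr>carrier := G\<rparr>) UNIV (\<lambda>g. g)) setdist)"

lemma group_isom_group: "group (isom_group :: ('a::metric_space \<Rightarrow> 'a) monoid)"
proof (rule groupI)
  fix f :: "'a \<Rightarrow> 'a" assume f: "f \<in> carrier isom_group"
  then have b: "bij f" and i: "\<And>s t. dist (f s) (f t) = dist s t"
    by (auto simp: isom_group_def isometric_on_def)
  have "dist (inv_into UNIV f s) (inv_into UNIV f t) = dist s t" for s t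
    by (metis b bij_inv_eq_iff i)
  then have "inv_into UNIV f \<in> carrier isom_group"
    using b by (auto simp: isom_group_def isometric_on_def bij_imp_bij_inv)
  moreover have "inv_into UNIV f \<otimes>\<^bsub>isom_group\<^esub> f = \<one>\<^bsub>isom_group\<^esub>"
    using b by (auto simp: isom_group_def bij_is_inj)
  ultimately show "\<exists>h\<in>carrier isom_group. h \<otimes>\<^bsub>isom_group\<^esub> f = \<one>\<^bsub>isom_group\<^esub>" by blast
qed (auto simp: isom_group_def isometric_on_def bij_comp comp_assoc)

lemma topspace_isom_topology:
  "topspace (isom_topology :: ('a::metric_space \<Rightarrow> 'a) topology) = carrier isom_group"
proof -
  have "carrier isom_group \<in> {{f \<in> carrier isom_group. f ` K \<subseteq> U} | K (U :: 'a set). compact K \<and> open U}"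
    by (intro CollectI exI[of _ "{}"] exI[of _ UNIV]) auto
  then show ?thesis
    unfolding isom_topology_def topology_generated_by_topspace by blast
qed

end

theory Submission
  imports Defs
begin

text \<open>
  A compact open subgroup of \<open>G\<close> fixes a point \<open>y\<close>, the circumcentre of one of its orbits, and by
  cocompactness the orbit of \<open>y\<close> is \<open>D\<close>-dense. An isometry fixing a \<open>D\<close>-dense subset of a large
  ball fixes a smaller concentric ball: otherwise a geodesic leaving its convex fixed-point set
  orthogonally could be prolonged to a point too far from that set. Hence pointwise stabilisers of
  balls are open. Now let \<open>h \<in> G\<close> have prime order \<open>p\<close>. Some fixed point of \<open>h\<close> has a unit ball that
  \<open>h\<close> does not fix, and after conjugation it lies within \<open>D\<close> of \<open>y\<close>. As \<open>p\<close> is prime, the powers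
  \<open>1, h, \<dots>, h\<^sup>p\<^sup>-\<^sup>1\<close> lie in different cosets of the open pointwise stabiliser of the ball of radius
  \<open>D + 1\<close> around \<open>y\<close>; but these powers lie in a compact subset of \<open>G\<close> depending only on \<open>D\<close>, which
  finitely many such cosets cover.
\<close>

section \<open>Geometry of CAT(0) spaces\<close>

text \<open>Retains the parametrisation that \<open>geodesic_segment\<close> discards, so that
  points on two sides can be addressed by proportional parameters.\<close>

definition geodesic_path :: "'a::metric_space \<Rightarrow> 'a \<Rightarrow> (real \<Rightarrow> 'a) \<Rightarrow> bool" where
  "geodesic_path x y c \<longleftrightarrow> isometric_on {0..dist x y} c \<and> c 0 = x \<and> c (dist x y) = y"

lemma geodesic_path_dist:
  assumes "geodesic_path x y c" "s \<in> {0..dist x y}" "t \<in> {0..dist x y}"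
  shows "dist (c s) (c t) = \<bar>s - t\<bar>"
  using assms by (auto simp: geodesic_path_def isometric_on_def dist_real_def)

lemma CAT0_geodesic_path:
  assumes "CAT0_space TYPE('a::metric_space)"
  obtains c where "geodesic_path (x::'a) y c"
proof -
  have "\<exists>S. geodesic_segment x y S"
    using assms by (simp add: CAT0_space_def geodesic_space_def)
  then show ?thesis using that by (auto simp: geodesic_segment_def geodesic_path_def)
qed

text \<open>For \<open>a > 0\<close> put \<open>x\<close> at the origin and \<open>y\<close> on the
  first axis. The law of cosines forces the first coordinate \<open>u\<close> of \<open>z\<close>,
  and the triangle inequalities give \<open>\<bar>u\<bar> \<le> b\<close>, which leaves room for a
  second coordinate.\<close>

lemma comparison_triangle:
  fixes a b c :: real
  assumes "0 \<le> a" "0 \<le> b" "0 \<le> c" "a \<le> b + c" "b \<le> a + c" "c \<le> a + b"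
  obtains x y z :: "real^2" where "dist x y = a" "dist x z = b" "dist y z = c"
proof (cases "a = 0")
  case True
  then have "b = c" using assms by auto
  have "dist (0::real^2) 0 = a" "dist (0::real^2) (b *\<^sub>R axis 1 1) = b"
    using True assms by (auto simp: norm_axis_1)
  then show ?thesis using that \<open>b = c\<close> by metis
next
  case False
  then have a: "a > 0" using assms by auto
  define u where "u = (a\<^sup>2 + b\<^sup>2 - c\<^sup>2) / (2*a)"
  have "a\<^sup>2 + b\<^sup>2 - c\<^sup>2 \<le> 2*a*b"
  proof -
    have "(a - b)\<^sup>2 \<le> c\<^sup>2" using assms by (intro abs_le_square_iff[THEN iffD1]) auto
    then show ?thesis by (simp add: power2_eq_square algebra_simps)
  qed
  then have ub: "u \<le> b" using a by (simp add: u_def divide_simps mult.commute mult.left_commute)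
  have "c\<^sup>2 \<le> (a + b)\<^sup>2" using assms by (intro power_mono) auto
  then have "-(2*a*b) \<le> a\<^sup>2 + b\<^sup>2 - c\<^sup>2" by (simp add: power2_eq_square algebra_simps)
  then have "-b \<le> u" using a by (simp add: u_def divide_simps mult.commute mult.left_commute)
  with ub have u2: "u\<^sup>2 \<le> b\<^sup>2" by (intro abs_le_square_iff[THEN iffD1]) auto
  define v where "v = sqrt (b\<^sup>2 - u\<^sup>2)"
  have v2: "v\<^sup>2 = b\<^sup>2 - u\<^sup>2" using u2 by (simp add: v_def)
  have d: "dist (vector [p, q] :: real^2) (vector [p', q']) = sqrt ((p - p')\<^sup>2 + (q - q')\<^sup>2)" for p q p' q'
    by (simp add: dist_vec_def L2_set_def sum_2 dist_real_def)
  have ac: "(a - u)\<^sup>2 + v\<^sup>2 = c\<^sup>2"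
  proof -
    have "2*a*u = a\<^sup>2 + b\<^sup>2 - c\<^sup>2" using a by (simp add: u_def)
    then show ?thesis unfolding v2 by (simp add: power2_eq_square algebra_simps)
  qed
  show ?thesis
  proof (rule that[of "vector [0,0]" "vector [a,0]" "vector [u,v]"])
    show "dist (vector [0, 0] :: real^2) (vector [a, 0]) = a" using a by (simp add: d)
    show "dist (vector [0, 0] :: real^2) (vector [u, v]) = b" using assms by (simp add: d v2)
    show "dist (vector [a, 0] :: real^2) (vector [u, v]) = c" using assms ac by (simp add: d)
  qed
qed

text \<open>A usable form of the axiom, which only speaks about given comparison triangles: here one
  is produced, with the comparison points written affinely at ratios \<open>s\<close> and
  \<open>t\<close>.\<close>

lemma CAT0_comparison:
  fixes x y z :: "'a::metric_space"
  assumes cat: "CAT0_space TYPE('a)"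
    and c: "geodesic_path x y c" and e: "geodesic_path x z e"
    and s: "0 \<le> s" "s \<le> 1" and t: "0 \<le> t" "t \<le> 1"
  obtains x' y' z' :: "real^2"
  where "dist x' y' = dist x y" "dist x' z' = dist x z" "dist y' z' = dist y z"
    and "dist (c (s * dist x y)) (e (t * dist x z))
           \<le> dist (x' + s *\<^sub>R (y' - x')) (x' + t *\<^sub>R (z' - x'))"
proof -
  obtain x' y' z' :: "real^2"
    where d: "dist x' y' = dist x y" "dist x' z' = dist x z" "dist y' z' = dist y z"
    by (rule comparison_triangle[of "dist x y" "dist x z" "dist y z"])
       (use dist_triangle[of x y z] dist_triangle[of x z y] dist_triangle[of y z x]
         in \<open>auto simp: dist_commute\<close>)
  \<comment> \<open>The axiom also asks for a third side, which the geodesic property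
    supplies.\<close>
  obtain k where k: "geodesic_path y z k" using CAT0_geodesic_path[OF cat] .
  have seg: "geodesic_segment x y (c ` {0..dist x y})" "geodesic_segment x z (e ` {0..dist x z})"
    "geodesic_segment y z (k ` {0..dist y z})"
    using c e k by (auto simp: geodesic_segment_def geodesic_path_def)
  have rs: "s * dist x y \<in> {0..dist x y}" and rt: "t * dist x z \<in> {0..dist x z}"
    using s t by (auto intro: mult_left_le_one_le)
  have "c 0 = x" "e 0 = x" using c e by (auto simp: geodesic_path_def)
  then have dx: "dist x (c (s * dist x y)) = s * dist x y" "dist x (e (t * dist x z)) = t * dist x z"
    using geodesic_path_dist[OF c _ rs, of 0] geodesic_path_dist[OF e _ rt, of 0] s t by auto
  have dx': "dist x' (x' + s *\<^sub>R (y' - x')) = s * dist x y" "dist x' (x' + t *\<^sub>R (z' - x')) = t * dist x z"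
    using d s t by (simp_all add: dist_norm norm_minus_commute)
  have cs: "x' + s *\<^sub>R (y' - x') \<in> closed_segment x' y'" "x' + t *\<^sub>R (z' - x') \<in> closed_segment x' z'"
    using s t unfolding closed_segment_def
    by (auto simp: algebra_simps intro: exI[of _ s] exI[of _ t])
  have "dist (c (s * dist x y)) (e (t * dist x z))
           \<le> dist (x' + s *\<^sub>R (y' - x')) (x' + t *\<^sub>R (z' - x'))"
    using cat[unfolded CAT0_space_def, THEN conjunct2, rule_format, of x y _ z _ _ x' y' z',
        OF conjI[OF seg(1) conjI[OF seg(2) conjI[OF seg(3) conjI[OF d(1) conjI[OF d(2) d(3)]]]]],
        OF imageI[OF rs] imageI[OF rt] cs]
    by (simp add: dx dx')
  with d that show ?thesis by blast
qed

text \<open>With equal ratios on both sides, the planar points arise from \<open>y'\<close> and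
  \<open>z'\<close> by a homothety centred at \<open>x'\<close>.\<close>

lemma CAT0_intercept:
  fixes x y z :: "'a::metric_space"
  assumes "CAT0_space TYPE('a)" "geodesic_path x y c" "geodesic_path x z e" "0 \<le> s" "s \<le> 1"
  shows "dist (c (s * dist x y)) (e (s * dist x z)) \<le> s * dist y z"
proof -
  obtain x' y' z' :: "real^2"
    where d: "dist y' z' = dist y z"
    and le: "dist (c (s * dist x y)) (e (s * dist x z))
           \<le> dist (x' + s *\<^sub>R (y' - x')) (x' + s *\<^sub>R (z' - x'))"
    using CAT0_comparison[OF assms assms(4,5)] by metis
  have "dist (x' + s *\<^sub>R (y' - x')) (x' + s *\<^sub>R (z' - x')) = norm (s *\<^sub>R (y' - z'))"
    unfolding dist_norm by (simp add: algebra_simps)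
  then show ?thesis using le d assms(4) by (simp add: dist_norm)
qed

text \<open>The CN inequality of Bruhat and Tits: the midpoint of one side is compared with the far
  end \<open>a\<close> of another, and the planar median is computed by the parallelogram
  law.\<close>

lemma CAT0_midpoint:
  fixes x y a :: "'a::metric_space"
  assumes cat: "CAT0_space TYPE('a)" and c: "geodesic_path x y c"
  shows "(dist (c (dist x y / 2)) a)\<^sup>2 \<le> ((dist x a)\<^sup>2 + (dist y a)\<^sup>2) / 2 - (dist x y)\<^sup>2 / 4"
proof -
  obtain e where e: "geodesic_path x a e" using CAT0_geodesic_path[OF cat] .
  obtain x' y' a' :: "real^2"
    where d: "dist x' y' = dist x y" "dist x' a' = dist x a" "dist y' a' = dist y a"
    and le: "dist (c (1/2 * dist x y)) (e (1 * dist x a))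
           \<le> dist (x' + (1/2) *\<^sub>R (y' - x')) (x' + 1 *\<^sub>R (a' - x'))"
    by (rule CAT0_comparison[OF cat c e, of "1/2" 1]) auto
  have ea: "e (dist x a) = a" using e by (simp add: geodesic_path_def)
  have eq: "(norm ((1/2) *\<^sub>R (v + w)))\<^sup>2 = ((norm v)\<^sup>2 + (norm w)\<^sup>2) / 2 - (norm (v - w))\<^sup>2 / 4" for v w :: "real^2"
    by (simp add: power2_norm_eq_inner inner_simps inner_commute field_simps del: norm_scaleR)
  have "x' + (1/2) *\<^sub>R (y' - x') - a' = (1/2) *\<^sub>R ((x' - a') + (y' - a'))"
    by (simp add: vec_eq_iff field_simps)
  then have "(dist (x' + (1/2) *\<^sub>R (y' - x')) a')\<^sup>2 = ((dist x a)\<^sup>2 + (dist y a)\<^sup>2) / 2 - (dist x y)\<^sup>2 / 4"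
    using eq[of "x' - a'" "y' - a'"] by (simp add: dist_norm d[symmetric])
  moreover have "(dist (c (dist x y / 2)) a)\<^sup>2 \<le> (dist (x' + (1/2) *\<^sub>R (y' - x')) a')\<^sup>2"
    using le ea by (intro power_mono) auto
  ultimately show ?thesis by simp
qed

text \<open>Two geodesics with common ends are sides of a degenerate triangle, so the intercept
  inequality bounds their distance by a multiple of \<open>dist y y\<close>.\<close>

lemma geodesic_path_unique:
  fixes x y :: "'a::metric_space"
  assumes cat: "CAT0_space TYPE('a)" and "geodesic_path x y c" "geodesic_path x y e" "t \<in> {0..dist x y}"
  shows "c t = e t"
proof (cases "x = y")
  case True
  then show ?thesis using assms by (auto simp: geodesic_path_def)
next
  case False
  then show ?thesis
    using CAT0_intercept[OF cat assms(2,3), of "t / dist x y"] assms(4) by (auto simp: divide_simps)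
qed

section \<open>Fixed points of isometries\<close>

lemma isometry_fixes_geodesic:
  fixes x y :: "'a::metric_space"
  assumes cat: "CAT0_space TYPE('a)" and h: "isometric_on UNIV h" "h x = x" "h y = y"
    and c: "geodesic_path x y c" "t \<in> {0..dist x y}"
  shows "h (c t) = c t"
proof -
  \<comment> \<open>The image is a geodesic with the same ends; by uniqueness, fixed-point sets are
    convex.\<close>
  have "geodesic_path x y (h \<circ> c)"
    using h c(1) by (simp add: geodesic_path_def isometric_on_def)
  from geodesic_path_unique[OF cat this c(1) c(2)] show ?thesis by simp
qed

text \<open>The radius function \<open>r\<close> has a unique minimiser, and every isometry
  preserving \<open>A\<close> preserves \<open>r\<close>. As \<open>p\<close> is chosen before
  \<open>f\<close>, it is a common fixed point of any group preserving \<open>A\<close>.\<close>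

lemma isometry_fixes_circumcenter:
  fixes A :: "'a::metric_space set"
  assumes prp: "proper_space TYPE('a)" and cat: "CAT0_space TYPE('a)"
    and A: "bounded A" "A \<noteq> {}"
  obtains p where "\<And>f. isometric_on UNIV f \<Longrightarrow> f ` A = A \<Longrightarrow> f p = p"
proof -
  define r where "r x = (SUP a\<in>A. dist x a)" for x
  have bdd: "bdd_above ((\<lambda>a. dist x a) ` A)" for x
    using A(1) by (meson bdd_above.I2 bounded_any_center)
  have le: "dist x a \<le> r x" if "a \<in> A" for x a
    unfolding r_def using bdd that by (intro cSUP_upper) auto
  have lipschitz: "r x \<le> r y + dist x y" for x y
    unfolding r_def
  proof (rule cSUP_least[OF A(2)])
    fix a assume "a \<in> A"
    have "dist x a \<le> dist x y + dist y a" by (rule dist_triangle)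
    also have "dist y a \<le> (SUP a\<in>A. dist y a)" using le[OF \<open>a \<in> A\<close>] by (simp add: r_def)
    finally show "dist x a \<le> (SUP a\<in>A. dist y a) + dist x y" by simp
  qed
  have cont: "continuous_on S r" for S
  proof (rule continuous_onI)
    fix x e assume "0 < (e::real)"
    have "dist (r x') (r x) \<le> dist x' x" for x'
      using lipschitz[of x x'] lipschitz[of x' x] by (auto simp: dist_real_def dist_commute)
    then show "\<exists>d>0. \<forall>x'\<in>S. dist x' x < d \<longrightarrow> dist (r x') (r x) \<le> e"
      using \<open>0 < e\<close> by (meson less_imp_le order_trans)
  qed
  obtain a0 where a0: "a0 \<in> A" using A(2) by blast
  have r0: "0 \<le> r x" for x using le[OF a0, of x] zero_le_dist order_trans by blast
  have "compact (cball a0 (r a0))" using prp by (simp add: proper_space_def)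
  from continuous_attains_inf[OF this _ cont]
  obtain m where m: "m \<in> cball a0 (r a0)" and min1: "\<And>y. y \<in> cball a0 (r a0) \<Longrightarrow> r m \<le> r y"
    using r0[of a0] by (metis centre_in_cball empty_iff)
  \<comment> \<open>Outside the compact ball \<open>r\<close> is at least \<open>r a0\<close>,
    because \<open>a0\<close> itself belongs to \<open>A\<close>; hence the minimum over the ball is
    global.\<close>
  have min: "r m \<le> r y" for y
  proof (cases "y \<in> cball a0 (r a0)")
    case False
    then have "r a0 \<le> r y" using le[OF a0, of y] by (simp add: dist_commute)
    then show ?thesis using min1[of a0] r0[of a0] by simp
  qed (use min1 in auto)
  \<comment> \<open>The CN inequality would put \<open>A\<close> in a strictly smaller ball around
    the midpoint of two distinct minimisers.\<close>
  have unique: "y = m" if "r y = r m" for y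
  proof (rule ccontr)
    assume "y \<noteq> m"
    obtain c where c: "geodesic_path m y c" using CAT0_geodesic_path[OF cat] .
    let ?p = "c (dist m y / 2)"
    have bd: "(dist ?p a)\<^sup>2 \<le> (r m)\<^sup>2 - (dist m y)\<^sup>2 / 4" if "a \<in> A" for a
    proof -
      have "(dist m a)\<^sup>2 \<le> (r m)\<^sup>2" "(dist y a)\<^sup>2 \<le> (r m)\<^sup>2"
        using le[OF that] \<open>r y = r m\<close> by (metis power_mono zero_le_dist)+
      then show ?thesis using CAT0_midpoint[OF cat c, of a] by (simp add: field_simps)
    qed
    have "r ?p \<le> sqrt ((r m)\<^sup>2 - (dist m y)\<^sup>2 / 4)"
      unfolding r_def[of ?p] using bd by (intro cSUP_least[OF A(2)] real_le_rsqrt) auto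
    also have "\<dots> < sqrt ((r m)\<^sup>2)" using \<open>y \<noteq> m\<close> by (intro real_sqrt_less_mono) simp
    also have "\<dots> = r m" using r0 by simp
    finally show False using min[of ?p] by simp
  qed
  show ?thesis
  proof
    fix f :: "'a \<Rightarrow> 'a" assume f: "isometric_on UNIV f" "f ` A = A"
    have "r (f m) = (SUP a\<in>f ` A. dist (f m) a)" by (simp add: r_def f(2))
    also have "\<dots> = r m" using f(1) by (simp add: r_def image_image isometric_on_def)
    finally show "f m = m" by (rule unique)
  qed
qed

text \<open>
  If \<open>y\<close> is not fixed and \<open>m\<close> is the fixed point nearest to \<open>y\<close>, prolong the geodesic from \<open>m\<close>
  through \<open>y\<close> to a point \<open>z\<close> at distance \<open>D + 1\<close> from \<open>m\<close>. A fixed point within distance \<open>D\<close> of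
  \<open>z\<close> would give, by the intercept inequality, a fixed point closer to \<open>y\<close> than \<open>m\<close>.
\<close>

lemma isometry_fixes_cball:
  fixes y0 :: "'a::metric_space"
  assumes prp: "proper_space TYPE('a)" and cat: "CAT0_space TYPE('a)"
    and compl: "geodesically_complete TYPE('a)"
    and h: "isometric_on UNIV h"
    and dense: "\<And>x. x \<in> cball y0 (r + D + 1) \<Longrightarrow> \<exists>w. dist x w \<le> D \<and> h w = w"
    and y: "y \<in> cball y0 r" and "D \<ge> 0"
  shows "h y = y"
proof (rule ccontr)
  assume ny: "h y \<noteq> y"
  define C where "C = {x. h x = x}"
  have "continuous_on UNIV h"
    by (rule continuous_onI) (use h in \<open>auto simp: isometric_on_def intro!: exI less_imp_le\<close>)
  then have "closed C" unfolding C_def by (intro closed_Collect_eq) (auto intro: continuous_intros)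
  obtain w where w: "dist y w \<le> D" "w \<in> C"
    using dense[of y] y \<open>D \<ge> 0\<close> by (force simp: C_def)
  have "compact (C \<inter> cball y D)"
    using prp \<open>closed C\<close> by (simp add: proper_space_def closed_Int_compact)
  from continuous_attains_inf[OF this, of "\<lambda>x. dist y x"]
  obtain m where m: "m \<in> C" "dist y m \<le> D" and min1: "\<And>x. x \<in> C \<Longrightarrow> dist y x \<le> D \<Longrightarrow> dist y m \<le> dist y x"
    using w by (force intro: continuous_intros)
  have min: "dist y m \<le> dist y x" if "x \<in> C" for x
    using min1[OF that] m by linarith
  have my: "dist m y > 0" "dist m y \<le> D" using m ny by (auto simp: C_def dist_commute)
  obtain c where c: "geodesic_path m y c" using CAT0_geodesic_path[OF cat] .
  then obtain l where l: "isometric_on UNIV l" "\<And>t. t \<in> {0..dist m y} \<Longrightarrow> l t = c t"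
    using compl my unfolding geodesically_complete_def geodesic_path_def by blast
  define z where "z = l (D + 1)"
  have l0: "l 0 = m" "l (dist m y) = y" using c l(2) by (auto simp: geodesic_path_def)
  have ld: "dist (l s) (l t) = \<bar>s - t\<bar>" for s t using l(1) by (simp add: isometric_on_def dist_real_def)
  have mz: "dist m z = D + 1" using ld[of 0 "D+1"] my by (simp add: z_def l0)
  have lz: "geodesic_path m z l" using l(1) mz l0 by (auto simp: geodesic_path_def z_def isometric_on_def)
  have "dist y z = D + 1 - dist m y" using ld[of "dist m y" "D+1"] my by (simp add: z_def l0)
  \<comment> \<open>Here \<open>dist y z \<le> D + 1\<close> accounts for the radius
    \<open>r + D + 1\<close> in the density hypothesis.\<close>
  then have "z \<in> cball y0 (r + D + 1)"
    using y my dist_triangle[of y0 z y] unfolding mem_cball by linarith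
  then obtain v where v: "dist z v \<le> D" "v \<in> C" using dense by (auto simp: C_def)
  obtain e where e: "geodesic_path m v e" using CAT0_geodesic_path[OF cat] .
  \<comment> \<open>The ratio at which \<open>y\<close> divides the side from \<open>m\<close> to
    \<open>z\<close>. The point \<open>q\<close> at the same ratio towards \<open>v\<close> is fixed
    because \<open>m\<close> and \<open>v\<close> are.\<close>
  define s where "s = dist m y / (D + 1)"
  have s: "0 < s" "s \<le> 1" "s * (D+1) = dist m y" using my \<open>D \<ge> 0\<close> by (simp_all add: s_def field_simps)
  define q where "q = e (s * dist m v)"
  have "dist y q \<le> s * dist z v"
    using CAT0_intercept[OF cat lz e, of s] s by (simp add: mz l0 q_def)
  also have "\<dots> \<le> s * D" using v s by simp
  also have "\<dots> < s * (D + 1)" using s(1) by simp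
  also have "\<dots> = dist y m" using s(3) by (simp add: dist_commute)
  finally have "dist y q < dist y m" .
  moreover have "q \<in> C"
    using isometry_fixes_geodesic[OF cat h _ _ e, of "s * dist m v"] m v s
    by (auto simp: C_def q_def mult_left_le_one_le)
  ultimately show False using min by force
qed

section \<open>The topology of the isometry group\<close>

lemma mem_isom_group: "f \<in> carrier isom_group \<longleftrightarrow> bij f \<and> isometric_on UNIV f"
  by (simp add: isom_group_def)

lemma isom_group_dist: "f \<in> carrier isom_group \<Longrightarrow> dist (f x) (f y) = dist x y"
  by (simp add: isom_group_def isometric_on_def)

text \<open>\<open>open\<close> on a function type refers to the product topology, so these are the
  basic neighbourhoods of pointwise convergence; all later openness arguments use such a finite
  \<open>F\<close> and radius.\<close>

lemma open_pointwise_ball: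
  fixes f :: "'b \<Rightarrow> 'a::metric_space"
  assumes "finite F"
  shows "open {g. \<forall>x\<in>F. dist (g x) (f x) < e}"
proof -
  have "{g. \<forall>x\<in>F. dist (g x) (f x) < e} = (\<Inter>x\<in>F. (\<lambda>g. g x) -` ball (f x) e)"
    by (auto simp: dist_commute)
  also have "open \<dots>"
    by (intro open_INT assms ballI open_vimage open_ball continuous_on_product_coordinates)
  finally show ?thesis .
qed

lemma open_contains_pointwise_ball:
  fixes U :: "('b \<Rightarrow> 'a::metric_space) set"
  assumes "open U" "f \<in> U"
  obtains F e where "finite F" "0 < e" "{g. \<forall>x\<in>F. dist (g x) (f x) < e} \<subseteq> U"
proof -
  obtain X where X: "f \<in> (\<Pi>\<^sub>E i\<in>UNIV. X i)" "\<And>i. open (X i)" "finite {i. X i \<noteq> UNIV}" "(\<Pi>\<^sub>E i\<in>UNIV. X i) \<subseteq> U"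
    using product_topology_open_contains_basis[of "\<lambda>_. euclidean" UNIV U f] assms
    by (auto simp: open_fun_def)
  define F where "F = {i. X i \<noteq> UNIV}"
  have "\<exists>d>0. ball (f i) d \<subseteq> X i" for i
    using X(1,2) by (metis PiE_mem UNIV_I openE)
  then obtain d where d: "\<And>i. d i > 0" "\<And>i. ball (f i) (d i) \<subseteq> X i" by metis
  \<comment> \<open>The inserted \<open>1\<close> provides for an empty \<open>F\<close>.\<close>
  define e where "e = Min (insert 1 (d ` F))"
  have "finite F" using X(3) by (simp add: F_def)
  then have e: "e \<le> d i" if "i \<in> F" for i using that by (auto simp: e_def)
  have "e > 0" using \<open>finite F\<close> d by (auto simp: e_def)
  moreover have "{g. \<forall>x\<in>F. dist (g x) (f x) < e} \<subseteq> U"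
  proof
    fix g assume g: "g \<in> {g. \<forall>x\<in>F. dist (g x) (f x) < e}"
    have "g i \<in> X i" for i
    proof (cases "i \<in> F")
      case True
      then have "g i \<in> ball (f i) (d i)" using g e[OF True] by (force simp: dist_commute)
      then show ?thesis using d by blast
    qed (simp add: F_def)
    then show "g \<in> U" using X(4) by (auto simp: PiE_UNIV_domain)
  qed
  ultimately show ?thesis using \<open>finite F\<close> that by blast
qed

lemma closure_pointwise_ball:
  fixes f :: "'b \<Rightarrow> 'a::metric_space"
  assumes "f \<in> closure S" "finite F" "0 < e"
  shows "\<exists>g\<in>S. \<forall>x\<in>F. dist (g x) (f x) < e"
proof -
  define B where "B = {g. \<forall>x\<in>F. dist (g x) (f x) < e}"
  have "f \<in> B" "open B" using assms open_pointwise_ball by (auto simp: B_def)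
  then have "B \<inter> S \<noteq> {}"
    using open_Int_closure_eq_empty[of B S] assms(1) by (metis IntI empty_iff)
  then obtain g where "g \<in> B" "g \<in> S" by (metis IntE ex_in_conv)
  then show ?thesis by (intro bexI[of _ g]) (simp_all add: B_def)
qed

text \<open>An isometry is determined up to \<open>e\<close> on a compact set by its values, up to \<open>e/3\<close>, on a
  finite \<open>e/3\<close>-net.\<close>

lemma isom_topology_eq_pointwise:
  "isom_topology = top_of_set (carrier isom_group :: ('a::metric_space \<Rightarrow> 'a) set)"
  unfolding topology_eq
proof (intro allI iffI)
  let ?C = "carrier isom_group :: ('a \<Rightarrow> 'a) set"
  fix W :: "('a \<Rightarrow> 'a) set"
  assume "openin isom_topology W"
  then have "generate_topology_on {{f \<in> ?C. f ` K \<subseteq> U} | K U. compact K \<and> open U} W"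
    unfolding isom_topology_def by (rule openin_topology_generated_by)
  then show "openin (top_of_set ?C) W"
  proof (rule generate_topology_on_coarsest[rotated 2])
    show "istopology (openin (top_of_set ?C))" by (rule istopology_openin)
    fix S assume "S \<in> {{f \<in> ?C. f ` K \<subseteq> U} | K U. compact K \<and> open U}"
    then obtain K U where KU: "compact K" "open U" and S: "S = {f \<in> ?C. f ` K \<subseteq> U}" by blast
    show "openin (top_of_set ?C) S"
    proof (subst openin_subopen, intro ballI)
      fix f assume f: "f \<in> S"
      have "continuous_on K f"
        by (rule continuous_onI) (use f in \<open>auto simp: S isom_group_dist intro!: exI less_imp_le\<close>)
      then have "compact (f ` K)" using KU by (intro compact_continuous_image)
      then obtain e where e: "e > 0" "(\<Union>x\<in>f ` K. ball x e) \<subseteq> U"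
        using compact_subset_open_imp_ball_epsilon_subset[OF _ KU(2), of "f ` K"] f S by auto
      have "e/3 > 0" using e by simp
      then obtain F where F: "finite F" "K \<subseteq> (\<Union>x\<in>F. ball x (e/3))"
        using KU(1) unfolding compact_eq_totally_bounded by blast
      have "?C \<inter> {g. \<forall>x\<in>F. dist (g x) (f x) < e/3} \<subseteq> S"
      proof
        fix g assume g: "g \<in> ?C \<inter> {g. \<forall>x\<in>F. dist (g x) (f x) < e/3}"
        have "g y \<in> U" if y: "y \<in> K" for y
        proof -
          obtain x where x: "x \<in> F" "y \<in> ball x (e/3)" using F y by blast
          have "dist (f y) (g y) \<le> dist (f y) (f x) + dist (f x) (g x) + dist (g x) (g y)"
            using dist_triangle[of "f y" "g y" "f x"] dist_triangle[of "f x" "g y" "g x"] by linarith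
          moreover have "dist (f y) (f x) < e/3" "dist (g x) (g y) < e/3" "dist (f x) (g x) < e/3"
            using x f g by (auto simp: S isom_group_dist dist_commute)
          ultimately have "g y \<in> ball (f y) e" by simp
          then show ?thesis using e y by blast
        qed
        then show "g \<in> S" using g by (auto simp: S)
      qed
      moreover have "f \<in> ?C \<inter> {g. \<forall>x\<in>F. dist (g x) (f x) < e/3}" using f e by (simp add: S)
      ultimately show "\<exists>T. openin (top_of_set ?C) T \<and> f \<in> T \<and> T \<subseteq> S"
        using openin_open_Int[OF open_pointwise_ball[OF F(1)]] by blast
    qed
  qed
next
  let ?C = "carrier isom_group :: ('a \<Rightarrow> 'a) set"
  fix W :: "('a \<Rightarrow> 'a) set"
  assume "openin (top_of_set ?C) W"
  then obtain U where U: "open U" "W = ?C \<inter> U" unfolding openin_open by blast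
  show "openin isom_topology W"
  proof (subst openin_subopen, intro ballI)
    fix f assume f: "f \<in> W"
    then obtain F e where F: "finite F" "0 < e" "{g. \<forall>x\<in>F. dist (g x) (f x) < e} \<subseteq> U"
      using open_contains_pointwise_ball[OF U(1)] U(2) by blast
    \<comment> \<open>Subbasic sets with \<open>K = {x}\<close> express pointwise closeness. The
      index \<open>undefined\<close> keeps the index set nonempty; outside \<open>F\<close> it
      contributes \<open>K = {}\<close>, which is no condition.\<close>
    let ?T = "\<Inter>x\<in>insert undefined F. {g \<in> ?C. g ` (if x \<in> F then {x} else {}) \<subseteq> ball (f x) e}"
    have "openin isom_topology ?T"
    proof (rule openin_INT2)
      fix x assume "x \<in> insert undefined F"
      show "openin isom_topology {g \<in> ?C. g ` (if x \<in> F then {x} else {}) \<subseteq> ball (f x) e}"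
        unfolding isom_topology_def
        by (rule topology_generated_by_Basis, intro CollectI exI conjI) auto
    qed (use F in auto)
    moreover have "f \<in> ?T" using f F U by auto
    moreover have "?T \<subseteq> W" using F U by (force simp: dist_commute)
    ultimately show "\<exists>T. openin isom_topology T \<and> f \<in> T \<and> T \<subseteq> W" by blast
  qed
qed

section \<open>Compactness of sets of isometries\<close>

lemma real_le_of_le_add_eps:
  fixes a b c :: real
  assumes le: "\<And>e. e > 0 \<Longrightarrow> a \<le> b + c * e" and "c > 0"
  shows "a \<le> b"
proof (rule field_le_epsilon)
  fix e :: real assume "e > 0"
  then show "a \<le> b + e" using le[of "e / c"] \<open>c > 0\<close> by simp
qed

text \<open>An Arzela-Ascoli argument: bounded displacement at \<open>x0\<close> confines each value
  \<open>f x\<close> to a compact ball, so Tychonoff applies, and it remains to see that pointwise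
  limits stay in the set.\<close>

lemma compact_isom_bounded_displacement:
  fixes x0 :: "'a::metric_space"
  assumes prp: "proper_space TYPE('a)"
  shows "compact {f \<in> carrier isom_group. dist (f x0) x0 \<le> r}" (is "compact ?S")
proof -
  let ?P = "\<Pi>\<^sub>E x\<in>UNIV. cball x0 (r + dist x x0)"
  have P: "compact ?P"
    using prp compactin_PiE[of "\<lambda>_. euclidean" "UNIV :: 'a set" "\<lambda>x. cball x0 (r + dist x x0)"]
    by (simp add: proper_space_def euclidean_product_topology)
  have SP: "?S \<subseteq> ?P"
  proof
    fix f assume f: "f \<in> ?S"
    have "dist x0 (f x) \<le> r + dist x x0" for x
      using dist_triangle[of x0 "f x" "f x0"] f isom_group_dist[of f x0 x] by (simp add: dist_commute)
    then show "f \<in> ?P" by (simp add: PiE_UNIV_domain)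
  qed
  have "closure ?S \<subseteq> ?S"
  proof
    fix f assume f: "f \<in> closure ?S"
    have iso: "dist (f x) (f y) = dist x y" for x y
    proof -
      have "dist (f x) (f y) \<le> dist x y + 2 * e \<and> dist x y \<le> dist (f x) (f y) + 2 * e" if e: "0 < e" for e
      proof -
        obtain g where g: "g \<in> ?S" "dist (g x) (f x) < e" "dist (g y) (f y) < e"
          using closure_pointwise_ball[OF f _ e, of "{x, y}"] by auto
        have "dist (g x) (g y) = dist x y" using g by (simp add: isom_group_dist)
        then show ?thesis
          using g(2,3) dist_triangle[of "f x" "f y" "g x"] dist_triangle[of "g x" "f y" "g y"]
            dist_triangle[of "g x" "g y" "f x"] dist_triangle[of "f x" "g y" "f y"]
          by (simp add: dist_commute)
      qed
      then show ?thesis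
        using real_le_of_le_add_eps[of "dist (f x) (f y)" "dist x y" 2]
          real_le_of_le_add_eps[of "dist x y" "dist (f x) (f y)" 2] by simp
    qed
    have bound: "dist (f x0) x0 \<le> r"
    proof (rule real_le_of_le_add_eps[where c = 1])
      fix e :: real assume "e > 0"
      then obtain g where g: "g \<in> ?S" "dist (g x0) (f x0) < e"
        using closure_pointwise_ball[OF f, of "{x0}" e] by blast
      then show "dist (f x0) x0 \<le> r + 1 * e"
        using dist_triangle[of "f x0" x0 "g x0"] by (simp add: dist_commute)
    qed simp
    \<comment> \<open>Surjectivity is the delicate property in the limit. Preimages of
      \<open>y\<close> under the approximating \<open>g\<close> stay in the one compact ball
      \<open>?B\<close>, so \<open>y\<close> lies in the closure of the image of \<open>?B\<close>
      under \<open>f\<close>, which is closed.\<close>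
    have "y \<in> range f" for y
    proof -
      let ?B = "cball x0 (r + dist y x0)"
      have B: "compact ?B" using prp by (simp add: proper_space_def)
      have "continuous_on ?B f"
        by (rule continuous_onI) (auto simp: iso intro!: exI less_imp_le)
      then have "closed (f ` ?B)" using B compact_continuous_image compact_imp_closed by blast
      moreover have "y \<in> closure (f ` ?B)"
        unfolding closure_approachable
      proof (intro allI impI)
        fix e :: real assume "e > 0"
        \<comment> \<open>\<open>g\<close> is close to \<open>f\<close> only on finite sets, hence
          the finite net; the preimage \<open>w\<close> of \<open>y\<close> is replaced by a nearby
          net point \<open>z\<close>.\<close>
        then have "?B \<subseteq> (\<Union>x\<in>?B. ball x (e/2))" by force
        from compactE_image[OF B _ this]
        obtain F where F: "F \<subseteq> ?B" "finite F" "?B \<subseteq> (\<Union>x\<in>F. ball x (e/2))" by auto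
        obtain g where g: "g \<in> ?S" "\<forall>z\<in>F. dist (g z) (f z) < e/2"
          using closure_pointwise_ball[OF f F(2), of "e/2"] \<open>e > 0\<close> unfolding half_gt_zero_iff by blast
        obtain w where w: "y = g w" using g(1) by (auto simp: mem_isom_group bij_def surj_def)
        have "dist w x0 = dist y (g x0)" using g(1) w by (simp add: isom_group_dist)
        then have "w \<in> ?B" using g(1) dist_triangle[of y "g x0" x0] by (simp add: dist_commute)
        then obtain z where z: "z \<in> F" "dist z w < e/2" using F by auto
        have "dist (f z) y \<le> dist (f z) (g z) + dist (g z) y" by (rule dist_triangle)
        also have "dist (g z) y = dist z w" using g(1) w by (simp add: isom_group_dist)
        finally have "dist (f z) y < e" using z(2) bspec[OF g(2) z(1)] dist_commute[of "f z" "g z"] by linarith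
        then show "\<exists>u\<in>f ` ?B. dist u y < e" using z F by blast
      qed
      ultimately show ?thesis by auto
    qed
    moreover have "inj f"
      by (rule injI) (use iso dist_eq_0_iff in metis)
    ultimately have "bij f" by (auto simp: bij_def)
    then show "f \<in> ?S" using iso bound by (simp add: mem_isom_group isometric_on_def)
  qed
  then have "closed ?S" by (simp add: closure_subset_eq)
  then have "compact (?P \<inter> ?S)" using P by (rule compact_Int_closed[rotated])
  then show ?thesis using SP by (simp add: Int_absorb1)
qed

lemma compact_closed_subset_bounded_displacement:
  fixes x0 :: "'a::metric_space"
  assumes "proper_space TYPE('a)" "closedin isom_topology G"
  shows "compact {g \<in> G. dist (g x0) x0 \<le> r}"
proof -
  obtain T where T: "closed T" "G = carrier isom_group \<inter> T"
    using assms(2) by (auto simp: isom_topology_eq_pointwise closedin_closed)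
  have "{g \<in> G. dist (g x0) x0 \<le> r} = {f \<in> carrier isom_group. dist (f x0) x0 \<le> r} \<inter> T"
    using T by auto
  then show ?thesis using compact_isom_bounded_displacement[OF assms(1)] T by (simp add: compact_Int_closed)
qed

section \<open>Open subgroups with a fixed point\<close>

lemma isom_subgroup:
  assumes "subgroup G isom_group"
  shows "G \<subseteq> carrier isom_group" "id \<in> G" "\<And>f g. f \<in> G \<Longrightarrow> g \<in> G \<Longrightarrow> f \<circ> g \<in> G"
    "\<And>f. f \<in> G \<Longrightarrow> inv_into UNIV f \<in> G"
proof -
  show sub: "G \<subseteq> carrier isom_group" using assms by (rule subgroup.subset)
  show "id \<in> G" using subgroup.one_closed[OF assms] by (simp add: isom_group_def)
  show comp: "f \<circ> g \<in> G" if "f \<in> G" "g \<in> G" for f g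
    using subgroup.m_closed[OF assms that] by (simp add: isom_group_def)
  show "inv_into UNIV f \<in> G" if f: "f \<in> G" for f
  proof -
    define k where "k = inv\<^bsub>isom_group\<^esub> f"
    have k: "k \<in> G" using subgroup.m_inv_closed[OF assms f] by (simp add: k_def)
    have "f \<in> carrier isom_group" using f sub by auto
    then have "f \<circ> k = id" "k \<circ> f = id"
      using group.r_inv[OF group_isom_group] group.l_inv[OF group_isom_group]
      by (auto simp: k_def isom_group_def)
    then have "inv_into UNIV f = k" by (metis inv_unique_comp)
    then show ?thesis using k by simp
  qed
qed

lemma isom_inv_apply:
  assumes "subgroup G isom_group" "g \<in> G"
  shows "inv_into UNIV g (g x) = x" "g (inv_into UNIV g x) = x"
proof -
  have "bij g" using isom_subgroup(1)[OF assms(1)] assms(2) by (auto simp: mem_isom_group)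
  then show "inv_into UNIV g (g x) = x" "g (inv_into UNIV g x) = x"
    by (simp_all add: bij_is_inj bij_is_surj surj_f_inv_f)
qed

text \<open>Quasi-components and components agree in a compact Hausdorff space.\<close>

lemma compact_totally_disconnected_clopen:
  assumes "compact_space T" "Hausdorff_space T" "totally_disconnected_space T"
    and x: "x \<in> topspace T" and U: "openin T U" "x \<in> U"
  obtains V where "openin T V" "closedin T V" "x \<in> V" "V \<subseteq> U"
proof -
  have "connectedin T (connected_component_of_set T x)" by (rule connectedin_connected_component_of)
  then obtain y where "connected_component_of_set T x \<subseteq> {y}"
    using assms(3) by (auto simp: totally_disconnected_space_def)
  moreover have "x \<in> connected_component_of_set T x" using x by (simp add: connected_component_of_refl)
  ultimately have "connected_component_of_set T x = {x}" by auto
  then have q: "quasi_component_of_set T x = {x}"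
    using quasi_eq_connected_component_of[of T x] assms by simp
  then have "{x} \<in> quasi_components_of T"
    using x by (auto simp: quasi_components_of_def intro!: image_eqI[where x = x])
  moreover have "compactin T (topspace T - U)"
    using assms(1) U(1) by (simp add: closedin_compact_space openin_closedin_eq closedin_diff)
  ultimately have "separated_between T {x} (topspace T - U)"
    using U(2) by (subst separated_between_quasi_component_compact) auto
  then obtain V W where VW: "openin T V" "openin T W" "V \<union> W = topspace T" "disjnt V W" "{x} \<subseteq> V"
      "topspace T - U \<subseteq> W"
    unfolding separated_between_def by blast
  have sub: "V \<subseteq> topspace T" using VW(1) by (rule openin_subset)
  have "V = topspace T - W" using VW by (auto simp: disjnt_iff)
  then have "closedin T V" using VW by auto
  moreover have "V \<subseteq> U" using VW sub by (auto simp: disjnt_iff)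
  ultimately show ?thesis using that VW by blast
qed

text \<open>A tube-lemma argument. Finitely many half-size neighbourhoods cover \<open>V\<close>; an
  isometry \<open>g\<close> that barely moves the points \<open>v x\<close> of their centres keeps
  \<open>g \<circ> w\<close> within the full-size neighbourhood of the centre near
  \<open>w\<close>.\<close>

lemma compact_open_neighbourhood_stable:
  fixes G :: "('a::metric_space \<Rightarrow> 'a) set"
  assumes "compact V" and "V \<subseteq> G" and sub: "subgroup G isom_group"
    and op: "\<And>v. v \<in> V \<Longrightarrow> \<exists>F e. finite F \<and> 0 < e \<and> {g \<in> G. \<forall>x\<in>F. dist (g x) (v x) < e} \<subseteq> V"
  obtains F e where "finite F" "0 < e"
    "\<And>g v. g \<in> G \<Longrightarrow> \<forall>x\<in>F. dist (g x) x < e \<Longrightarrow> v \<in> V \<Longrightarrow> g \<circ> v \<in> V"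
proof -
  have "\<forall>v\<in>V. \<exists>p. finite (fst p) \<and> 0 < snd p \<and> {g \<in> G. \<forall>x\<in>fst p. dist (g x) (v x) < snd p} \<subseteq> V"
  proof
    fix v assume "v \<in> V"
    then obtain F e where "finite F" "0 < e" "{g \<in> G. \<forall>x\<in>F. dist (g x) (v x) < e} \<subseteq> V"
      using op by blast
    then show "\<exists>p. finite (fst p) \<and> 0 < snd p \<and> {g \<in> G. \<forall>x\<in>fst p. dist (g x) (v x) < snd p} \<subseteq> V"
      by (intro exI[of _ "(F, e)"]) simp
  qed
  from bchoice[OF this] obtain p where p: "\<forall>v\<in>V. finite (fst (p v)) \<and> 0 < snd (p v) \<and>
      {g \<in> G. \<forall>x\<in>fst (p v). dist (g x) (v x) < snd (p v)} \<subseteq> V" ..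
  define F e where "F v = fst (p v)" and "e v = snd (p v)" for v
  have Fe: "finite (F v)" "0 < e v" "{g \<in> G. \<forall>x\<in>F v. dist (g x) (v x) < e v} \<subseteq> V"
    if "v \<in> V" for v
    using bspec[OF p that] by (simp_all add: F_def e_def)
  have "V \<subseteq> (\<Union>v\<in>V. {g. \<forall>x\<in>F v. dist (g x) (v x) < e v / 2})"
  proof
    fix v assume v: "v \<in> V"
    have "dist (v x) (v x) < e v / 2" for x using Fe(2)[OF v] by simp
    then show "v \<in> (\<Union>v\<in>V. {g. \<forall>x\<in>F v. dist (g x) (v x) < e v / 2})" using v by blast
  qed
  from compactE_image[OF assms(1) open_pointwise_ball this] Fe(1)
  obtain D where D: "D \<subseteq> V" "finite D" "V \<subseteq> (\<Union>v\<in>D. {g. \<forall>x\<in>F v. dist (g x) (v x) < e v / 2})"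
    by blast
  define d where "d = Min (insert 1 (e ` D)) / 2"
  have "0 < Min (insert 1 (e ` D))" using D(1,2) Fe(2) by auto
  then have d: "0 < d" by (simp add: d_def)
  have dle: "d \<le> e v / 2" if "v \<in> D" for v
    using Min_le[of "insert 1 (e ` D)" "e v"] D(2) that by (simp add: d_def)
  show ?thesis
  proof (rule that[OF _ d])
    show "finite (\<Union>v\<in>D. v ` F v)" using D Fe(1) by auto
    fix g w assume g: "g \<in> G" "\<forall>x\<in>(\<Union>v\<in>D. v ` F v). dist (g x) x < d" and w: "w \<in> V"
    obtain v where v: "v \<in> D" "\<And>x. x \<in> F v \<Longrightarrow> dist (w x) (v x) < e v / 2" using D(3) w by blast
    have "dist ((g \<circ> w) x) (v x) < e v" if x: "x \<in> F v" for x
    proof -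
      have "dist (g (v x)) (v x) < d" using g v x by blast
      moreover have "dist (g (w x)) (g (v x)) = dist (w x) (v x)"
        using g isom_subgroup(1)[OF sub] isom_group_dist by blast
      ultimately show ?thesis
        using v(2)[OF x] dle[OF v(1)] dist_triangle[of "g (w x)" "v x" "g (v x)"] by simp
    qed
    moreover have "g \<circ> w \<in> G" using g w \<open>V \<subseteq> G\<close> isom_subgroup(3)[OF sub] by blast
    ultimately show "g \<circ> w \<in> V" using Fe(3)[of v] v D by blast
  qed
qed

text \<open>The stabiliser \<open>H\<close> under left multiplication of a compact open set \<open>V \<ni> id\<close> is an open
  subgroup contained in \<open>V\<close> (van Dantzig), so its orbits are bounded.\<close>

lemma exists_point_open_stabiliser:
  fixes G :: "('a::metric_space \<Rightarrow> 'a) set"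
  assumes prp: "proper_space TYPE('a)" and cat: "CAT0_space TYPE('a)"
    and sub: "subgroup G isom_group" and cl: "closedin isom_topology G"
    and td: "totally_disconnected_space (subtopology isom_topology G)"
  obtains y F e where "finite F" "0 < e" "\<And>g. g \<in> G \<Longrightarrow> \<forall>x\<in>F. dist (g x) x < e \<Longrightarrow> g y = y"
proof -
  fix x0 :: 'a
  note G = isom_subgroup[OF sub]
  have Gd: "dist (g x) (g y) = dist x y" if "g \<in> G" for g x y
    using G(1) that isom_group_dist by blast
  define K where "K = {g \<in> G. dist (g x0) x0 \<le> 1}"
  have K: "compact K" "K \<subseteq> G"
    unfolding K_def by (rule compact_closed_subset_bounded_displacement[OF prp cl], blast)
  let ?T = "top_of_set K"
  have cs: "compact_space ?T" using K by (simp add: compact_space_subtopology)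
  have "Hausdorff_space (euclidean :: ('a \<Rightarrow> 'a) topology)"
    unfolding euclidean_product_topology[symmetric] by (simp add: Hausdorff_space_product_topology)
  then have hs: "Hausdorff_space ?T" by (rule Hausdorff_space_subtopology)
  have "subtopology isom_topology G = top_of_set G"
    using G(1) by (simp add: isom_topology_eq_pointwise subtopology_subtopology Int_absorb1)
  with td have tK: "totally_disconnected_space ?T"
    using K(2) by (fastforce simp: totally_disconnected_space_def connectedin_subtopology)
  \<comment> \<open>The strict bound makes \<open>V\<close>, which is only open relative to
    \<open>K\<close>, open in \<open>G\<close> as well.\<close>
  have open_x0: "open {g :: 'a \<Rightarrow> 'a. \<forall>x\<in>{x0}. dist (g x) (id x) < 1}"
    by (rule open_pointwise_ball) simp
  have idK: "id \<in> K" using G by (simp add: K_def)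
  obtain V where V: "openin ?T V" "closedin ?T V" "id \<in> V"
      "V \<subseteq> K \<inter> {g. \<forall>x\<in>{x0}. dist (g x) (id x) < 1}"
  proof (rule compact_totally_disconnected_clopen[OF cs hs tK])
    show "id \<in> topspace ?T" using idK by simp
    show "openin ?T (K \<inter> {g. \<forall>x\<in>{x0}. dist (g x) (id x) < 1})"
      by (rule openin_open_Int[OF open_x0])
  qed (use idK in auto)
  have cV: "compact V" using V(2) K(1) closedin_compact by blast
  have VG: "V \<subseteq> G" using V(4) K(2) by blast
  have "\<exists>F e. finite F \<and> 0 < e \<and> {g \<in> G. \<forall>x\<in>F. dist (g x) (v x) < e} \<subseteq> V" if v: "v \<in> V" for v
  proof -
    obtain W where W: "open W" "V = K \<inter> W" using V(1) unfolding openin_open by blast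
    have "open (W \<inter> {g. \<forall>x\<in>{x0}. dist (g x) (id x) < 1})" using W open_x0 by (intro open_Int)
    moreover have "v \<in> W \<inter> {g. \<forall>x\<in>{x0}. dist (g x) (id x) < 1}" using v V(4) W by blast
    ultimately obtain F e where Fe: "finite F" "0 < e"
        "{g. \<forall>x\<in>F. dist (g x) (v x) < e} \<subseteq> W \<inter> {g. \<forall>x\<in>{x0}. dist (g x) (id x) < 1}"
      using open_contains_pointwise_ball by blast
    have "{g \<in> G. \<forall>x\<in>F. dist (g x) (v x) < e} \<subseteq> V"
    proof
      fix g assume g: "g \<in> {g \<in> G. \<forall>x\<in>F. dist (g x) (v x) < e}"
      then have "g \<in> W" "dist (g x0) x0 < 1" using Fe(3) by auto
      then show "g \<in> V" using g W by (simp add: K_def)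
    qed
    with Fe show ?thesis by blast
  qed
  from compact_open_neighbourhood_stable[OF cV VG sub this]
  obtain F e where Fe: "finite F" "0 < e"
    and stab: "\<And>g v. g \<in> G \<Longrightarrow> \<forall>x\<in>F. dist (g x) x < e \<Longrightarrow> v \<in> V \<Longrightarrow> g \<circ> v \<in> V"
    by blast
  \<comment> \<open>Equality rather than inclusion makes \<open>H\<close> closed under
    inverses.\<close>
  define H where "H = {g \<in> G. (\<lambda>v. g \<circ> v) ` V = V}"
  have HV: "H \<subseteq> V"
  proof
    fix g assume "g \<in> H"
    then have "g \<circ> id \<in> V" using V(3) unfolding H_def by blast
    then show "g \<in> V" by simp
  qed
  \<comment> \<open>\<open>g\<close> and its inverse displace each point equally far, so stability
    of \<open>V\<close> applies to both and gives the two inclusions.\<close>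
  have NH: "g \<in> H" if g: "g \<in> G" "\<forall>x\<in>F. dist (g x) x < e" for g
  proof -
    let ?k = "inv_into UNIV g"
    have k: "?k \<in> G" using g G(4) by blast
    have "dist (?k x) x = dist (g x) x" for x
      using Gd[OF g(1), of "?k x" x] isom_inv_apply[OF sub g(1)] by (simp add: dist_commute)
    then have k2: "?k \<circ> v \<in> V" if "v \<in> V" for v using stab[OF k _ that] g(2) by simp
    have "v \<in> (\<lambda>v. g \<circ> v) ` V" if "v \<in> V" for v
      using k2[OF that] isom_inv_apply[OF sub g(1)] by (intro image_eqI[of _ _ "?k \<circ> v"]) auto
    then have "(\<lambda>v. g \<circ> v) ` V = V" using stab[OF g] by blast
    then show ?thesis using g by (simp add: H_def)
  qed
  have idH: "id \<in> H" using G(2) by (simp add: H_def)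
  have compH: "f \<circ> g \<in> H" if "f \<in> H" "g \<in> H" for f g
  proof -
    have "(\<lambda>v. (f \<circ> g) \<circ> v) ` V = (\<lambda>v. f \<circ> v) ` (\<lambda>v. g \<circ> v) ` V"
      by (simp add: image_image comp_assoc)
    then show ?thesis using that G(3) by (simp add: H_def)
  qed
  have invH: "inv_into UNIV g \<in> H" if g: "g \<in> H" for g
  proof -
    have gG: "g \<in> G" and gV: "(\<lambda>v. g \<circ> v) ` V = V" using g by (auto simp: H_def)
    have "(\<lambda>v. inv_into UNIV g \<circ> v) ` V = (\<lambda>v. inv_into UNIV g \<circ> v) ` (\<lambda>v. g \<circ> v) ` V"
      by (simp add: gV)
    also have "\<dots> = (\<lambda>v. v) ` V"
      unfolding image_image
      by (rule image_cong) (auto simp: fun_eq_iff isom_inv_apply[OF sub gG])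
    finally show ?thesis using G(4)[OF gG] by (simp add: H_def)
  qed
  define A where "A = (\<lambda>h. h x0) ` H"
  have "A \<subseteq> cball x0 1" using HV V(4) by (auto simp: A_def K_def dist_commute)
  then have "bounded A" using bounded_cball bounded_subset by blast
  moreover have "A \<noteq> {}" using idH by (auto simp: A_def)
  ultimately obtain y where y: "\<And>f. isometric_on UNIV f \<Longrightarrow> f ` A = A \<Longrightarrow> f y = y"
    using isometry_fixes_circumcenter[OF prp cat] by metis
  have "g y = y" if g: "g \<in> H" for g
  proof (rule y)
    have gG: "g \<in> G" using g by (simp add: H_def)
    then show "isometric_on UNIV g" using Gd by (simp add: isometric_on_def)
    have "g ` A \<subseteq> A"
    proof (unfold A_def image_image, rule image_subsetI)
      fix h assume "h \<in> H"
      then show "g (h x0) \<in> (\<lambda>h. h x0) ` H"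
        by (intro image_eqI[of _ _ "g \<circ> h"] compH[OF g]) simp_all
    qed
    moreover have "A \<subseteq> g ` A"
    proof
      fix a assume "a \<in> A"
      then obtain h where h: "h \<in> H" "a = h x0" by (auto simp: A_def)
      have "(inv_into UNIV g \<circ> h) x0 \<in> A" using compH[OF invH[OF g] h(1)] unfolding A_def by blast
      moreover have "a = g ((inv_into UNIV g \<circ> h) x0)"
        using h by (simp add: isom_inv_apply[OF sub gG])
      ultimately show "a \<in> g ` A" by blast
    qed
    ultimately show "g ` A = A" by blast
  qed
  then show ?thesis using that[OF Fe] NH by blast
qed

section \<open>Counting cosets\<close>

lemma isom_subgroup_funpow:
  assumes sub: "subgroup G isom_group" and g: "g \<in> G"
  shows "g ^^ n \<in> G"
proof (induction n)
  case 0
  then show ?case using isom_subgroup(2)[OF sub] by (simp only: funpow.simps)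
next
  case (Suc n)
  then show ?case using isom_subgroup(3)[OF sub g] by (simp only: funpow.simps)
qed

section \<open>Orbits and the quotient metric\<close>

lemma orbit_isom_group: "orbit (isom_group\<lparr>carrier := G\<rparr>) (\<lambda>g. g) x = (\<lambda>g. g x) ` G"
  by (auto simp: orbit_def)

text \<open>Translating by a group element fixes the first point at \<open>x\<close>. Only elements
  displacing \<open>y\<close> by at most \<open>2 * dist x y\<close> can compete with
  \<open>id\<close>, and these form a compact set.\<close>

lemma setdist_orbits_attained:
  fixes x y :: "'a::metric_space"
  assumes prp: "proper_space TYPE('a)" and sub: "subgroup G isom_group"
    and cl: "closedin isom_topology G"
  obtains g where "g \<in> G" "setdist ((\<lambda>g. g x) ` G) ((\<lambda>g. g y) ` G) = dist x (g y)"
proof -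
  note G = isom_subgroup[OF sub]
  have Gd: "dist (g a) (g b) = dist a b" if "g \<in> G" for g a b
    using G(1) that isom_group_dist by blast
  let ?S = "{g \<in> G. dist (g y) y \<le> 2 * dist x y}"
  have S: "compact ?S" by (rule compact_closed_subset_bounded_displacement[OF prp cl])
  have "id \<in> ?S" using G(2) by simp
  moreover have "continuous_on ?S (\<lambda>g. dist x (g y))"
    by (intro continuous_on_dist continuous_on_const
        continuous_on_subset[OF continuous_on_product_coordinates subset_UNIV])
  ultimately obtain g where g: "g \<in> ?S" "\<And>h. h \<in> ?S \<Longrightarrow> dist x (g y) \<le> dist x (h y)"
    using continuous_attains_inf[OF S] by (metis (no_types, lifting) empty_iff)
  have min: "dist x (g y) \<le> dist x (h y)" if "h \<in> G" for h
  proof (cases "h \<in> ?S")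
    case False
    then have "dist x y \<le> dist x (h y)"
      using that dist_triangle[of "h y" y x] by (simp add: dist_commute)
    then show ?thesis using g(2)[OF \<open>id \<in> ?S\<close>] by simp
  qed (rule g(2))
  have "setdist ((\<lambda>g. g x) ` G) ((\<lambda>g. g y) ` G) \<le> dist x (g y)"
    using g(1) G(2) by (intro setdist_le_dist) (auto intro: image_eqI[of _ _ id])
  moreover have "dist x (g y) \<le> setdist ((\<lambda>g. g x) ` G) ((\<lambda>g. g y) ` G)"
  proof (rule le_setdistI)
    fix a b assume "a \<in> (\<lambda>g. g x) ` G" "b \<in> (\<lambda>g. g y) ` G"
    then obtain h k where hk: "h \<in> G" "k \<in> G" "a = h x" "b = k y" by blast
    have "dist x ((inv_into UNIV h \<circ> k) y) = dist (h x) (k y)"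
      using Gd[OF hk(1), of x "inv_into UNIV h (k y)"] isom_inv_apply[OF sub hk(1)] by simp
    then show "dist x (g y) \<le> dist a b" using min[OF G(3)[OF G(4)[OF hk(1)] hk(2)]] hk by simp
  qed (use G(2) in auto)
  ultimately show ?thesis using that g(1) by force
qed

text \<open>Needed to apply facts about metric spaces to the topology in \<open>cocompact\<close>.
  Attained distances yield both separation of distinct orbits and the triangle inequality.\<close>

lemma Metric_space_orbits:
  assumes prp: "proper_space TYPE('a::metric_space)" and sub: "subgroup (G :: ('a \<Rightarrow> 'a) set) isom_group"
    and cl: "closedin isom_topology G"
  shows "Metric_space (orbits (isom_group\<lparr>carrier := G\<rparr>) UNIV (\<lambda>g. g)) setdist"
proof -
  note G = isom_subgroup[OF sub]
  have Gd: "dist (g a) (g b) = dist a b" if "g \<in> G" for g a b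
    using G(1) that isom_group_dist by blast
  let ?o = "\<lambda>x :: 'a. (\<lambda>g. g x) ` G"
  have orb: "orbits (isom_group\<lparr>carrier := G\<rparr>) UNIV (\<lambda>g. g) = range ?o"
    by (auto simp: orbits_def orbit_isom_group)
  have eq: "?o (g y) = ?o y" if g: "g \<in> G" for g y
  proof
    show "?o (g y) \<subseteq> ?o y"
    proof (rule image_subsetI)
      fix h assume "h \<in> G"
      then show "h (g y) \<in> ?o y" by (intro image_eqI[of _ _ "h \<circ> g"] G(3) g) simp_all
    qed
    show "?o y \<subseteq> ?o (g y)"
    proof (rule image_subsetI)
      fix h assume "h \<in> G"
      then show "h y \<in> ?o (g y)"
        by (intro image_eqI[of _ _ "h \<circ> inv_into UNIV g"] G(3,4) g) (simp_all add: isom_inv_apply[OF sub g])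
    qed
  qed
  show ?thesis
    unfolding orb
  proof
    fix A B assume "A \<in> range ?o" "B \<in> range ?o"
    then obtain x y where AB: "A = ?o x" "B = ?o y" by blast
    obtain g where g: "g \<in> G" "setdist (?o x) (?o y) = dist x (g y)"
      by (rule setdist_orbits_attained[OF prp sub cl])
    show "(setdist A B = 0) = (A = B)"
    proof
      assume "setdist A B = 0"
      then have "x = g y" using g AB by simp
      then show "A = B" using eq[OF g(1), of y] AB by simp
    next
      assume "A = B"
      moreover have "setdist (?o x) (?o x) \<le> dist (id x) (id x)"
        using G(2) by (intro setdist_le_dist) blast+
      ultimately show "setdist A B = 0" using AB(1) by (intro antisym setdist_pos_le) simp
    qed
  next
    fix A B C assume "A \<in> range ?o" "B \<in> range ?o" "C \<in> range ?o"
    then obtain x y z where AB: "A = ?o x" "B = ?o y" "C = ?o z" by blast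
    obtain g where g: "g \<in> G" "setdist (?o x) (?o y) = dist x (g y)"
      by (rule setdist_orbits_attained[OF prp sub cl])
    obtain k where k: "k \<in> G" "setdist (?o y) (?o z) = dist y (k z)"
      by (rule setdist_orbits_attained[OF prp sub cl])
    have "setdist (?o x) (?o z) \<le> dist x ((g \<circ> k) z)"
      using G(2) G(3)[OF g(1) k(1)] by (intro setdist_le_dist) (auto intro: image_eqI[of _ _ id] image_eqI[of _ _ "g \<circ> k"])
    also have "\<dots> \<le> dist x (g y) + dist (g y) (g (k z))" by (simp add: dist_triangle)
    also have "dist (g y) (g (k z)) = dist y (k z)" by (rule Gd[OF g(1)])
    finally show "setdist A C \<le> setdist A B + setdist B C" using g k AB by simp
  qed (simp_all add: setdist_pos_le setdist_sym)
qed

text \<open>A compact quotient is bounded, and orbit distances are attained.\<close>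

lemma cocompact_orbit_coarsely_dense:
  fixes y :: "'a::metric_space"
  assumes prp: "proper_space TYPE('a)" and sub: "subgroup G isom_group"
    and cl: "closedin isom_topology G" and co: "cocompact G"
  obtains D where "0 \<le> D" "\<And>x. \<exists>g\<in>G. dist x (g y) \<le> D"
proof -
  interpret M: Metric_space "orbits (isom_group\<lparr>carrier := G\<rparr>) UNIV (\<lambda>g. g)" setdist
    by (rule Metric_space_orbits[OF prp sub cl])
  let ?o = "\<lambda>x :: 'a. (\<lambda>g. g x) ` G"
  have orb: "orbits (isom_group\<lparr>carrier := G\<rparr>) UNIV (\<lambda>g. g) = range ?o"
    by (auto simp: orbits_def orbit_isom_group)
  have "compactin M.mtopology (orbits (isom_group\<lparr>carrier := G\<rparr>) UNIV (\<lambda>g. g))"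
    using co unfolding cocompact_def compact_space_def by (simp only: M.topspace_mtopology)
  then have "M.mbounded (orbits (isom_group\<lparr>carrier := G\<rparr>) UNIV (\<lambda>g. g))"
    by (rule M.compactin_imp_mbounded)
  then obtain B where "\<forall>X\<in>range ?o. \<forall>Y\<in>range ?o. setdist X Y \<le> B"
    unfolding M.mbounded_alt unfolding orb by blast
  then have B: "setdist (?o x) (?o y) \<le> B" for x by blast
  have "\<exists>g\<in>G. dist x (g y) \<le> B" for x
    using B[of x] setdist_orbits_attained[OF prp sub cl, of x y] by metis
  moreover have "0 \<le> B" using B[of y] setdist_pos_le order_trans by blast
  ultimately show ?thesis using that by blast
qed

text \<open>Near every point of a finite net lies a translate \<open>k z y\<close>. It is fixed by
  \<open>g\<close> once the conjugate of \<open>g\<close> by \<open>k z\<close> is close to the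
  identity on \<open>F\<close>, so finitely many conditions make the fixed points of
  \<open>g\<close> dense enough for \<open>isometry_fixes_cball\<close>.\<close>

lemma pointwise_stabiliser_of_cball_open:
  fixes y :: "'a::metric_space"
  assumes prp: "proper_space TYPE('a)" and cat: "CAT0_space TYPE('a)"
    and compl: "geodesically_complete TYPE('a)" and sub: "subgroup G isom_group"
    and Fe: "finite F" "0 < e" "\<And>g. g \<in> G \<Longrightarrow> \<forall>x\<in>F. dist (g x) x < e \<Longrightarrow> g y = y"
    and D: "0 \<le> D" "\<And>x. \<exists>g\<in>G. dist x (g y) \<le> D"
  obtains F' where "finite F'"
    "\<And>g z. g \<in> G \<Longrightarrow> \<forall>x\<in>F'. dist (g x) x < e \<Longrightarrow> z \<in> cball y r \<Longrightarrow> g z = z"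
proof -
  note G = isom_subgroup[OF sub]
  have Gd: "dist (g a) (g b) = dist a b" if "g \<in> G" for g a b
    using G(1) that isom_group_dist by blast
  \<comment> \<open>The density constant is \<open>D + 1\<close>: orbit density \<open>D\<close>
    plus net mesh \<open>1\<close>.\<close>
  let ?B = "cball y (r + (D + 1) + 1)"
  obtain Z where Z: "finite Z" "?B \<subseteq> (\<Union>z\<in>Z. ball z 1)"
    using prp zero_less_one unfolding proper_space_def compact_eq_totally_bounded by metis
  obtain k where k: "\<And>z. k z \<in> G" "\<And>z. dist z (k z y) \<le> D" using D(2) by metis
  show ?thesis
  proof
    show "finite (\<Union>z\<in>Z. k z ` F)" using Z Fe by simp
    fix g w assume g: "g \<in> G" "\<forall>x\<in>(\<Union>z\<in>Z. k z ` F). dist (g x) x < e" and w: "w \<in> cball y r"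
    have k_fixed: "g (k z y) = k z y" if z: "z \<in> Z" for z
    proof -
      let ?h = "inv_into UNIV (k z) \<circ> (g \<circ> k z)"
      note inv = isom_inv_apply[OF sub k(1)[of z]]
      have "?h y = y"
      proof (rule Fe(3))
        show "?h \<in> G" by (intro G(3,4) g(1) k(1))
        have "dist (?h x) x = dist (g (k z x)) (k z x)" for x
          using Gd[OF k(1)[of z], of "?h x" x] inv by simp
        then show "\<forall>x\<in>F. dist (?h x) x < e" using g(2) z by auto
      qed
      then show ?thesis using inv by (metis comp_apply)
    qed
    show "g w = w"
    proof (rule isometry_fixes_cball[OF prp cat compl _ _ w])
      show "isometric_on UNIV g" using Gd[OF g(1)] by (simp add: isometric_on_def)
      fix x assume "x \<in> ?B"
      then obtain z where z: "z \<in> Z" "dist z x < 1" using Z(2) by auto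
      have "dist x (k z y) \<le> D + 1"
        using z(2) k(2)[of z] dist_triangle[of x "k z y" z] by (simp add: dist_commute)
      then show "\<exists>w. dist x w \<le> D + 1 \<and> g w = w" using k_fixed[OF z(1)] by blast
    qed (use D(1) in simp)
  qed
qed

section \<open>Isometries of finite order\<close>

lemma periodic_isometry_fixes_point:
  fixes h :: "'a::metric_space \<Rightarrow> 'a"
  assumes prp: "proper_space TYPE('a)" and cat: "CAT0_space TYPE('a)"
    and h: "isometric_on UNIV h" "h ^^ n = id" "0 < n"
  obtains x where "h x = x"
proof -
  fix x0 :: 'a
  \<comment> \<open>A finite set invariant under \<open>h\<close>, whose circumcentre is therefore
    fixed.\<close>
  define A where "A = (\<lambda>i. (h ^^ i) x0) ` {..<n}"
  have "h ` A \<subseteq> A"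
  proof (unfold A_def image_image, rule image_subsetI)
    fix i assume "i \<in> {..<n}"
    show "h ((h ^^ i) x0) \<in> (\<lambda>i. (h ^^ i) x0) ` {..<n}"
    proof (cases "Suc i = n")
      case True
      have "h ((h ^^ i) x0) = (h ^^ Suc i) x0" by simp
      also have "\<dots> = (h ^^ 0) x0" using h(2) True by simp
      finally show ?thesis using h(3) by (intro image_eqI[of _ _ 0]) auto
    next
      case False
      then show ?thesis using \<open>i \<in> {..<n}\<close> by (intro image_eqI[of _ _ "Suc i"]) auto
    qed
  qed
  moreover have "A \<subseteq> h ` A"
  proof
    fix a assume "a \<in> A"
    then obtain i where i: "i < n" "a = (h ^^ i) x0" by (auto simp: A_def)
    show "a \<in> h ` A"
    proof (cases i)
      case 0
      obtain m where m: "n = Suc m" using h(3) gr0_implies_Suc by blast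
      have "a = (h ^^ n) x0" using i 0 h(2) by simp
      then have "a = h ((h ^^ m) x0)" using m by simp
      then show ?thesis using m by (simp add: A_def)
    next
      case (Suc m)
      then show ?thesis using i by (simp add: A_def)
    qed
  qed
  ultimately have "h ` A = A" by blast
  moreover have "bounded A" by (simp add: A_def finite_imp_bounded)
  moreover have "A \<noteq> {}" using h(3) by (auto simp: A_def)
  ultimately show ?thesis using isometry_fixes_circumcenter[OF prp cat] h(1) that by metis
qed

text \<open>Walk in unit steps along a geodesic from \<open>x0\<close> to a moved point: some step
  leads from a fixed point to a moved one.\<close>

lemma isometry_fixes_boundary_point:
  fixes h :: "'a::metric_space \<Rightarrow> 'a"
  assumes cat: "CAT0_space TYPE('a)" and h: "h x0 = x0" "h \<noteq> id"
  obtains x w where "h x = x" "h w \<noteq> w" "dist x w \<le> 1"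
proof -
  obtain v where v: "h v \<noteq> v" using h(2) by (auto simp: fun_eq_iff)
  obtain c where c: "geodesic_path x0 v c" using CAT0_geodesic_path[OF cat] .
  define L where "L = dist x0 v"
  define q where "q n = c (min (real n) L)" for n
  have L: "0 \<le> L" by (simp add: L_def)
  have c0: "c 0 = x0" "c L = v" using c by (auto simp: geodesic_path_def L_def)
  obtain N where "L \<le> real N" using real_arch_simple by blast
  then have "h (q N) \<noteq> q N" using v c0 by (simp add: q_def min_def)
  moreover have "h (q 0) = q 0" using h(1) c0 L by (simp add: q_def)
  ultimately obtain n where n: "h (q n) = q n" "h (q (Suc n)) \<noteq> q (Suc n)"
    using nat_induct[of "\<lambda>n. h (q n) = q n" N] by blast
  have "dist (q n) (q (Suc n)) = \<bar>min (real n) L - min (real (Suc n)) L\<bar>"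
    unfolding q_def using L by (intro geodesic_path_dist[OF c]) (auto simp: L_def)
  also have "\<dots> \<le> 1" by (auto simp: min_def)
  finally show ?thesis using that n by blast
qed

text \<open>By Bezout some power of \<open>h ^^ m\<close> equals \<open>h\<close>, up to a power of
  \<open>h ^^ p\<close>.\<close>

lemma funpow_coprime_fixed_point:
  fixes h :: "'b \<Rightarrow> 'b"
  assumes "h ^^ p = id" "(h ^^ m) w = w" "coprime m p" "0 < m"
  shows "h w = w"
proof -
  obtain a b where ab: "m * a = p * b + 1"
    using bezout_nat[of m p] assms(3,4) by auto
  have pb: "(h ^^ (p * b)) = id"
    by (simp add: funpow_mult[symmetric] assms(1) del: funpow_mult)
  have "(((h ^^ m) ^^ a)) w = w" by (induction a) (simp_all add: assms(2))
  then have "(h ^^ (m * a)) w = w" by (simp add: funpow_mult)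
  then have "(h ^^ (p * b + 1)) w = w" by (simp only: ab)
  moreover have "(h ^^ (p * b + 1)) w = h ((h ^^ (p * b)) w)" by simp
  ultimately show ?thesis by (simp only: pb id_apply)
qed

section \<open>The uniform bound\<close>

lemma isom_group_pow: "g [^]\<^bsub>isom_group\<^esub> (n::nat) = g ^^ n"
  by (induction n) (simp_all add: isom_group_def nat_pow_def fun_eq_iff funpow_swap1)

lemma prime_order_bounded:
  fixes G :: "('a::metric_space \<Rightarrow> 'a) set"
  assumes prp: "proper_space TYPE('a)" and compl: "geodesically_complete TYPE('a)"
    and cat: "CAT0_space TYPE('a)"
    and sub: "subgroup G isom_group" and cl: "closedin isom_topology G"
    and td: "totally_disconnected_space (subtopology isom_topology G)"
    and co: "cocompact G"
  obtains M :: nat where "\<And>h p. h \<in> G \<Longrightarrow> prime p \<Longrightarrow> h \<noteq> id \<Longrightarrow> h ^^ p = id \<Longrightarrow> p \<le> M"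
proof -
  note G = isom_subgroup[OF sub]
  have Gd: "dist (g a) (g b) = dist a b" if "g \<in> G" for g a b
    using G(1) that isom_group_dist by blast
  obtain y :: 'a and F0 e where Fe: "finite F0" "0 < e"
      "\<And>g. g \<in> G \<Longrightarrow> \<forall>x\<in>F0. dist (g x) x < e \<Longrightarrow> g y = y"
    using exists_point_open_stabiliser[OF prp cat sub cl td] by metis
  obtain D where D: "0 \<le> D" "\<And>x. \<exists>g\<in>G. dist x (g y) \<le> D"
    using cocompact_orbit_coarsely_dense[OF prp sub cl co] by metis
  obtain F where F: "finite F"
      "\<And>g z. g \<in> G \<Longrightarrow> \<forall>x\<in>F. dist (g x) x < e \<Longrightarrow> z \<in> cball y (D + 1) \<Longrightarrow> g z = z"
    by (rule pointwise_stabiliser_of_cball_open[where y = y and r = "D + 1",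
          OF prp cat compl sub Fe(1,2) _ D(1)])
      (use Fe(3) D(2) in blast)+
  \<comment> \<open>An isometry with a fixed point within \<open>D\<close> of \<open>y\<close>
    displaces \<open>y\<close> by at most \<open>2 * D\<close>. The cover of \<open>?S\<close> is
    chosen before \<open>h\<close>, so its size is a uniform bound.\<close>
  let ?S = "{g \<in> G. dist (g y) y \<le> 2 * D}"
  let ?N = "\<lambda>v. {g. \<forall>x\<in>F. dist (g x) (v x) < e / 2}"
  have S: "compact ?S" by (rule compact_closed_subset_bounded_displacement[OF prp cl])
  have "v \<in> ?N v" for v :: "'a \<Rightarrow> 'a" using Fe(2) by simp
  then have cover: "?S \<subseteq> (\<Union>v\<in>?S. ?N v)" by blast
  obtain V where V: "finite V" "?S \<subseteq> (\<Union>v\<in>V. ?N v)"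
    by (rule compactE_image[OF S open_pointwise_ball[OF F(1)] cover])
  show ?thesis
  proof (rule that[of "card V"], rule ccontr)
    fix h :: "'a \<Rightarrow> 'a" and p :: nat
    assume h: "h \<in> G" "prime p" "h \<noteq> id" "h ^^ p = id" and "\<not> p \<le> card V"
    have "isometric_on UNIV h" using Gd[OF h(1)] by (simp add: isometric_on_def)
    then obtain x0 where "h x0 = x0"
      using periodic_isometry_fixes_point[OF prp cat _ h(4)] prime_gt_0_nat[OF h(2)] by metis
    then obtain x w where xw: "h x = x" "h w \<noteq> w" "dist x w \<le> 1"
      using isometry_fixes_boundary_point[OF cat _ h(3)] by metis
    obtain k where k: "k \<in> G" "dist x (k y) \<le> D" using D(2) by blast
    note inv = isom_inv_apply[OF sub k(1)]
    note pow = isom_subgroup_funpow[OF sub h(1)]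
    have powx: "(h ^^ i) x = x" for i by (induction i) (simp_all add: xw)
    \<comment> \<open>Conjugation by \<open>k\<close> brings the fixed point \<open>x\<close> within
      \<open>D\<close> of \<open>y\<close>.\<close>
    define g where "g i = inv_into UNIV k \<circ> ((h ^^ i) \<circ> k)" for i
    have gG: "g i \<in> G" for i unfolding g_def by (intro G(3,4) k pow)
    have kg: "k (g i z) = (h ^^ i) (k z)" for i z by (simp add: g_def inv)
    have "g i \<in> ?S" for i
    proof -
      have "dist (g i y) y = dist ((h ^^ i) (k y)) (k y)"
        using Gd[OF k(1), of "g i y" y] by (simp add: kg)
      also have "\<dots> \<le> dist ((h ^^ i) (k y)) ((h ^^ i) x) + dist x (k y)"
        by (metis dist_triangle powx)
      also have "\<dots> \<le> 2 * D" using Gd[OF pow, of i "k y" x] k(2) by (simp add: dist_commute)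
      finally show ?thesis using gG by simp
    qed
    then have "\<forall>i. \<exists>v. v \<in> V \<and> g i \<in> ?N v" using V(2) by blast
    from choice[OF this] obtain f where f: "\<And>i. f i \<in> V" "\<And>i. g i \<in> ?N (f i)" by blast
    have "card (f ` {..<p}) \<le> card V" by (rule card_mono[OF V(1)]) (use f in blast)
    \<comment> \<open>Two of the \<open>p\<close> conjugates share a neighbourhood of radius
      \<open>e / 2\<close>. Cancelling the isometry \<open>g i\<close> leaves \<open>g m\<close>,
      which displaces each point of \<open>F\<close> by less than \<open>e\<close>.\<close>
    then have "\<not> inj_on f {..<p}" using pigeonhole[of f "{..<p}"] \<open>\<not> p \<le> card V\<close> by simp
    then obtain i j where ij: "i < p" "j < p" "i < j" "f i = f j"
      unfolding inj_on_def by (metis lessThan_iff linorder_neqE_nat)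
    define m where "m = j - i"
    have m: "0 < m" "m < p" "j = i + m" using ij by (auto simp: m_def)
    have "dist (g m z) z < e" if z: "z \<in> F" for z
    proof -
      have "dist (g i z) (f i z) < e / 2" "dist (g j z) (f i z) < e / 2"
        using f(2)[of i] f(2)[of j] ij(4) z by auto
      then have "dist (g j z) (g i z) < e"
        using dist_triangle[of "g j z" "g i z" "f i z"] by (simp add: dist_commute)
      moreover have "dist (g j z) (g i z) = dist ((h ^^ i) ((h ^^ m) (k z))) ((h ^^ i) (k z))"
        using Gd[OF k(1), of "g j z" "g i z"] by (simp add: kg m(3) funpow_add)
      moreover have "\<dots> = dist (k (g m z)) (k z)" by (simp only: Gd[OF pow] kg)
      moreover have "\<dots> = dist (g m z) z" by (rule Gd[OF k(1)])
      ultimately show ?thesis by simp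
    qed
    \<comment> \<open>The moved point \<open>w\<close>, pulled back by \<open>k\<close>, falls into
      the ball that \<open>g m\<close> fixes pointwise.\<close>
    moreover have "inv_into UNIV k w \<in> cball y (D + 1)"
    proof -
      have "dist y (inv_into UNIV k w) = dist (k y) w"
        using Gd[OF k(1), of y "inv_into UNIV k w"] by (simp add: inv)
      also have "\<dots> \<le> dist x (k y) + dist x w" by (rule dist_triangle3)
      finally show ?thesis using k(2) xw(3) by simp
    qed
    ultimately have "g m (inv_into UNIV k w) = inv_into UNIV k w" using F(2)[OF gG] by blast
    then have "(h ^^ m) w = w" using kg[of m "inv_into UNIV k w"] by (simp add: inv)
    moreover have "coprime m p"
      using prime_imp_coprime_nat[OF h(2), of m] nat_dvd_not_less[OF m(1,2)]
      by (simp add: coprime_commute)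
    ultimately have "h w = w" using funpow_coprime_fixed_point[OF h(4)] m(1) by blast
    then show False using xw(2) by contradiction
  qed
qed

text \<open>\<open>ord\<close> is \<open>0\<close> on elements of infinite order, which the premise
  excludes. A prime factor \<open>p\<close> of the order of \<open>g\<close> is the order of a power
  of \<open>g\<close>.\<close>

theorem corollary4:
  fixes G :: "('a::metric_space \<Rightarrow> 'a) set"
  assumes "proper_space TYPE('a)"
    and "geodesically_complete TYPE('a)"
    and "CAT0_space TYPE('a)"
    and "subgroup G isom_group"
    and "closedin isom_topology G"
    and "totally_disconnected_space (subtopology isom_topology G)"
    and "unimodular (isom_group\<lparr>carrier := G\<rparr>) (subtopology isom_topology G)"
    and "cocompact G"
  shows "\<exists>M::nat. \<forall>g\<in>G. group.ord isom_group g \<noteq> 0 \<longrightarrow>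
           (\<forall>p\<in>prime_factors (group.ord isom_group g). p \<le> M)"
proof -
  obtain M :: nat where M: "\<And>h p. h \<in> G \<Longrightarrow> prime p \<Longrightarrow> h \<noteq> id \<Longrightarrow> h ^^ p = id \<Longrightarrow> p \<le> M"
    using prime_order_bounded[OF assms(1-6,8)] by blast
  have "p \<le> M" if g: "g \<in> G" and n: "group.ord isom_group g \<noteq> 0"
    and p: "p \<in> prime_factors (group.ord isom_group g)" for g p
  proof -
    interpret group "isom_group :: ('a \<Rightarrow> 'a) monoid" by (rule group_isom_group)
    have gc: "g \<in> carrier isom_group" using isom_subgroup(1)[OF assms(4)] g by blast
    have pr: "prime p" "p dvd ord g" using p by auto
    then obtain m where m: "ord g = p * m" by blast
    have one: "\<one>\<^bsub>isom_group\<^esub> = (id :: 'a \<Rightarrow> 'a)" by (simp add: isom_group_def)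
    \<comment> \<open>Since \<open>0 < m < ord g\<close>, the power \<open>g ^^ m\<close> is
      nontrivial, while its \<open>p\<close>-th power is the identity.\<close>
    have "\<not> ord g dvd m"
      using m n prime_gt_1_nat[OF pr(1)] by (auto dest: dvd_imp_le)
    then have "g ^^ m \<noteq> id" using pow_eq_id[OF gc, of m] by (simp add: isom_group_pow one)
    moreover have "(g ^^ m) ^^ p = id"
      using pow_ord_eq_1[OF gc] by (simp add: isom_group_pow one m funpow_mult mult.commute)
    moreover have "g ^^ m \<in> G" using assms(4) g by (rule isom_subgroup_funpow)
    ultimately show ?thesis using M pr(1) by blast
  qed
  then show ?thesis by blast
qed

end
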